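(* For every real number $\lambda$ and all integers $j,k,p$, $$\sum_{r=p}^{\infty}\tan^{-1}\left\{\frac{\lambda L_{2j-1}F_{4jr-2r+2k-1}}{F_{4jr-2r+2k-1}^2-F_{2j-1}^2+\lambda^2}\right\}=\tan^{-1}\left(\frac{\lambda}{F_{4jp-2p+2k-2j}}\right).$$
   Context: $F_i$ ($i\in\mathbb{Z}$) are the Fibonacci numbers, defined by $F_0=0$, $F_1=1$, $F_i=F_{i-1}+F_{i-2}$ for all integers $i$. $L_i$ ($i\in\mathbb{Z}$) are the Lucas numbers, defined by $L_0=2$, $L_1=1$, $L_i=L_{i-1}+L_{i-2}$ for all integers $i$. $\tan^{-1}$ denotes the principal value of the arctangent. An infinite sum $\sum_{r=p}^\infty$ denotes the limit of the partial sums $\sum_{r=p}^N$ as $N\to\infty$.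
   Formalization: Adds the condition that for every r ≥ p, with n=4jr−2r+2k−1, either F_n²−F_{2j−1}²>0 or F_n²−F_{2j−1}²+λ²<0; without it the identity is undefined or off by ±π (e.g. λ=j=k=1, p=−1: the sum is 3π/4, the right side −π/4). *)

theory Defs
  imports Complex_Main
begin

function Fib :: "int \<Rightarrow> int" where
  "Fib i = (if i = 0 then 0 else if i = 1 then 1
            else if i > 1 then Fib (i - 1) + Fib (i - 2)
            else Fib (i + 2) - Fib (i + 1))"
  by auto
termination
  by (relation "measure (\<lambda>i. nat (if i \<ge> 0 then i else 1 - i))") auto

function Luc :: "int \<Rightarrow> int" where
  "Luc i = (if i = 0 then 2 else if i = 1 then 1
            else if i > 1 then Luc (i - 1) + Luc (i - 2)
            else Luc (i + 2) - Luc (i + 1))"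
  by auto
termination
  by (relation "measure (\<lambda>i. nat (if i \<ge> 0 then i else 1 - i))") auto

declare Fib.simps [simp del] Luc.simps [simp del]

lemma Fib_0: "Fib 0 = 0" and Fib_1: "Fib 1 = 1"
  by (simp_all add: Fib.simps)

lemma Fib_rec: "Fib i = Fib (i - 1) + Fib (i - 2)"
proof (cases "i > 1")
  case True
  then show ?thesis by (subst Fib.simps) simp
next
  case False
  then show ?thesis using Fib.simps [of "i - 2"] by simp
qed

lemma Luc_0: "Luc 0 = 2" and Luc_1: "Luc 1 = 1"
  by (simp_all add: Luc.simps)

lemma Luc_rec: "Luc i = Luc (i - 1) + Luc (i - 2)"
proof (cases "i > 1")
  case True
  then show ?thesis by (subst Luc.simps) simp
next
  case False
  then show ?thesis using Luc.simps [of "i - 2"] by simp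
qed

(* Side condition on the denominators.  Write n = 4jr - 2r + 2k - 1 and m = 2j - 1.  Since m is odd
   and n - m is even,
     Fib n ^ 2 - Fib m ^ 2 = Fib (n - m) * Fib (n + m)   and
     Luc m * Fib n = Fib (n + m) - Fib (n - m),
   so the r-th summand is the telescoping difference
     arctan (lam / Fib (n - m)) - arctan (lam / Fib (n + m)),
   but for principal values only up to a multiple of pi.  The condition
     Fib n ^ 2 - Fib m ^ 2 > 0  or  Fib n ^ 2 - Fib m ^ 2 + lam ^ 2 < 0
   says that both quotients are defined and (for lam nonzero) that their product exceeds -1, which
   is when the difference formula holds for the principal value.  Consecutive values Fib (n - m),
   Fib (n + m) change sign at most once as r increases, so such errors cannot cancel: when all the
   denominators occurring in the summation formula are nonzero, the formula holds if and only if
   the condition holds for every r >= p.  The next lemma shows that it cannot be dropped: for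
   lam = j = k = 1 and p = -1 no denominator vanishes, yet the formula fails. *)

lemma Fib_odd_pos: "Fib (2 * r + 1) > 0"
proof -
  have pos: "Fib (2 * int n + 1) > 0 \<and> Fib (2 * int n + 2) > 0" for n
  proof (induction n)
    case 0
    show ?case using Fib_rec [of 2] by (simp add: Fib_0 Fib_1)
  next
    case (Suc n)
    then show ?case
      using Fib_rec [of "2 * int n + 3"] Fib_rec [of "2 * int n + 4"] by (simp add: algebra_simps)
  qed
  have neg: "Fib (1 - 2 * int n) > 0 \<and> Fib (- 2 * int n) \<le> 0" for n
  proof (induction n)
    case 0
    show ?case by (simp add: Fib_0 Fib_1)
  next
    case (Suc n)
    have "Fib (1 - 2 * int n) = Fib (- 2 * int n) + Fib (1 - 2 * int (Suc n))"
      using Fib_rec [of "1 - 2 * int n"] by simp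
    moreover have "Fib (- 2 * int n) = Fib (1 - 2 * int (Suc n)) + Fib (- 2 * int (Suc n))"
    proof -
      have "- 2 * int n - 1 = 1 - 2 * int (Suc n)" "- 2 * int n - 2 = - 2 * int (Suc n)"
        by simp_all
      then show ?thesis using Fib_rec [of "- 2 * int n"] by metis
    qed
    ultimately show ?case using Suc.IH by linarith
  qed
  show ?thesis
  proof (cases "r \<ge> 0")
    case True
    then show ?thesis using pos [of "nat r"] by simp
  next
    case False
    then show ?thesis using neg [of "nat (- r)"] by (simp add: algebra_simps)
  qed
qed

lemma side_condition_needed:
  fixes lam :: real and j k p :: int
  assumes eqs: "lam = 1" "j = 1" "k = 1" "p = -1"
  shows "real_of_int (Fib (4*j*r - 2*r + 2*k - 1))^2 - real_of_int (Fib (2*j - 1))^2 + lam^2 \<noteq> 0"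
    and "Fib (4*j*p - 2*p + 2*k - 2*j) \<noteq> 0"
    and "\<not> ((\<lambda>N::int. \<Sum>r = p..N.
        arctan (lam * real_of_int (Luc (2*j - 1)) * real_of_int (Fib (4*j*r - 2*r + 2*k - 1)) /
          (real_of_int (Fib (4*j*r - 2*r + 2*k - 1))^2 - real_of_int (Fib (2*j - 1))^2 + lam^2)))
      \<longlongrightarrow> arctan (lam / real_of_int (Fib (4*j*p - 2*p + 2*k - 2*j)))) at_top"
proof -
  have odd: "Fib (4*j*r - 2*r + 2*k - 1) > 0" for r
    using Fib_odd_pos [of r] by (simp add: eqs algebra_simps)
  have even: "Fib (4*j*p - 2*p + 2*k - 2*j) = -1"
    using Fib_rec [of 0] Fib_rec [of 1] by (simp add: eqs Fib_0 Fib_1)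
  show "real_of_int (Fib (4*j*r - 2*r + 2*k - 1))^2 - real_of_int (Fib (2*j - 1))^2 + lam^2 \<noteq> 0"
    using odd [of r] by (simp add: eqs Fib_1)
  show "Fib (4*j*p - 2*p + 2*k - 2*j) \<noteq> 0"
    using even by simp
  show "\<not> ((\<lambda>N::int. \<Sum>r = p..N.
        arctan (lam * real_of_int (Luc (2*j - 1)) * real_of_int (Fib (4*j*r - 2*r + 2*k - 1)) /
          (real_of_int (Fib (4*j*r - 2*r + 2*k - 1))^2 - real_of_int (Fib (2*j - 1))^2 + lam^2)))
      \<longlongrightarrow> arctan (lam / real_of_int (Fib (4*j*p - 2*p + 2*k - 2*j)))) at_top"
    (is "\<not> (?S \<longlongrightarrow> ?R) at_top")
  proof
    assume lim: "(?S \<longlongrightarrow> ?R) at_top"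
    have "?S N \<ge> 0" for N
    proof (rule sum_nonneg)
      fix r
      show "arctan (lam * real_of_int (Luc (2*j - 1)) * real_of_int (Fib (4*j*r - 2*r + 2*k - 1)) /
          (real_of_int (Fib (4*j*r - 2*r + 2*k - 1))^2 - real_of_int (Fib (2*j - 1))^2 + lam^2)) \<ge> 0"
        using odd [of r] by (simp add: eqs Fib_1 Luc_1)
    qed
    then have "0 \<le> ?R"
      by (intro tendsto_lowerbound [OF lim]) auto
    then show False
      unfolding even by (simp add: eqs arctan_minus)
  qed
qed

end

theory Submission
  imports Defs
begin

text \<open>
  With m = 2j - 1 and n = 2mr + 2k - 1, the addition law and Cassini's identity give
  F(n+m) - F(n-m) = L(m) F(n) and F(n+m) F(n-m) = F(n)^2 - F(m)^2, so the summand is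
  arctan (lam / F(n-m)) - arctan (lam / F(n+m)). The hypothesis makes the product of the two
  arguments exceed -1, so this holds for principal values. Replacing r by r + 1 turns n - m into
  n + m; the sum telescopes, and the remainder vanishes since even-indexed Fibonacci numbers
  satisfy |F(2i)| >= |i|.
\<close>

section \<open>Difference of principal arctangents\<close>

text \<open>Since \<open>cos (arctan x)\<close> and \<open>cos (arctan y)\<close> are positive, the
  cosine of the difference has the sign of \<open>1 + x * y\<close>. Positivity, together with the a
  priori bound \<open>pi\<close> on the absolute value, forces the difference into the interval
  where \<open>arctan\<close> inverts \<open>tan\<close>.\<close>

lemma arctan_diff_eq:
  fixes x y :: real
  assumes "x * y > -1"
  shows "arctan x - arctan y = arctan ((x - y) / (1 + x * y))"
proof -
  let ?t = "arctan x - arctan y"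
  have cp: "cos (arctan x) > 0" "cos (arctan y) > 0"
    by (simp_all add: cos_arctan add_pos_nonneg)
  have "sin (arctan z) = z * cos (arctan z)" for z :: real
    by (simp add: sin_arctan cos_arctan)
  then have c: "cos ?t = (1 + x * y) * (cos (arctan x) * cos (arctan y))"
    and s: "sin ?t = (x - y) * (cos (arctan x) * cos (arctan y))"
    by (simp_all add: cos_diff sin_diff algebra_simps)
  have cpos: "cos ?t > 0"
    unfolding c using assms cp by simp
  have bounds: "\<bar>?t\<bar> < pi"
    using arctan_lbound[of x] arctan_ubound[of x] arctan_lbound[of y] arctan_ubound[of y]
    by linarith
  have "\<bar>?t\<bar> < pi / 2"
  proof (rule ccontr)
    assume "\<not> \<bar>?t\<bar> < pi / 2"
    then have "cos \<bar>?t\<bar> \<le> cos (pi / 2)"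
      using bounds by (intro cos_monotone_0_pi_le) auto
    with cpos show False by simp
  qed
  then have "- (pi / 2) < ?t" "?t < pi / 2"
    by linarith+
  then have "arctan (tan ?t) = ?t"
    by (rule arctan_tan)
  moreover have "tan ?t = (x - y) / (1 + x * y)"
    unfolding tan_def c s using cp by simp
  ultimately show ?thesis by simp
qed

section \<open>Fibonacci and Lucas identities at integer indices\<close>

lemma Fib_step: "Fib (i + 2) = Fib (i + 1) + Fib i"
  using Fib_rec[of "i + 2"] by (simp add: algebra_simps)

lemma Fib_add: "Fib (n + m) = Fib m * Fib (n + 1) + Fib (m - 1) * Fib n"
proof -
  \<comment> \<open>The recurrence has order two, so the induction, upwards and downwards from 0,
    carries two consecutive values of \<open>m\<close>.\<close>
  have "Fib (n + m) = Fib m * Fib (n + 1) + Fib (m - 1) * Fib n \<and>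
      Fib (n + m + 1) = Fib (m + 1) * Fib (n + 1) + Fib m * Fib n"
  proof (induction m rule: int_induct[where k = 0])
    case base
    show ?case using Fib_rec[of 1] by (simp add: Fib_0 Fib_1)
  next
    case (step1 i)
    then show ?case
      using Fib_step[of "n + i"] Fib_step[of i] Fib_step[of "i - 1"] by (simp add: algebra_simps)
  next
    case (step2 i)
    then show ?case
      using Fib_step[of "n + i - 1"] Fib_step[of "i - 1"] Fib_step[of "i - 2"]
      by (simp add: algebra_simps)
  qed
  then show ?thesis ..
qed

lemma Luc_eq_Fib: "Luc m = Fib (m + 1) + Fib (m - 1)"
proof -
  have "Luc m = Fib (m + 1) + Fib (m - 1) \<and> Luc (m + 1) = Fib (m + 2) + Fib m"
  proof (induction m rule: int_induct[where k = 0])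
    case base
    show ?case using Fib_rec[of 1] Fib_rec[of 2] by (simp add: Fib_0 Fib_1 Luc_0 Luc_1)
  next
    case (step1 i)
    then show ?case
      using Luc_rec[of "i + 2"] Fib_step[of "i + 1"] Fib_step[of "i - 1"]
      by (simp add: algebra_simps)
  next
    case (step2 i)
    then show ?case
      using Luc_rec[of "i + 1"] Fib_step[of i] Fib_step[of "i - 2"] Fib_step[of "i - 1"]
      by (simp add: algebra_simps)
  qed
  then show ?thesis ..
qed

text \<open>The reflection law F(-n) = (-1)^(n+1) F(n), split by parity so that no power of -1 with
  an integer exponent appears.\<close>

lemma Fib_reflect: "Fib (- (2 * i)) = - Fib (2 * i)" "Fib (- 1 - 2 * i) = Fib (2 * i + 1)"
proof -
  have "Fib (- (2 * i)) = - Fib (2 * i) \<and> Fib (- 1 - 2 * i) = Fib (2 * i + 1)"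
  proof (induction i rule: int_induct[where k = 0])
    case base
    show ?case using Fib_rec[of 1] by (simp add: Fib_0 Fib_1)
  next
    case (step1 i)
    then show ?case
      using Fib_step[of "2 * i"] Fib_step[of "2 * i + 1"]
        Fib_step[of "- 2 - 2 * i"] Fib_step[of "- 3 - 2 * i"]
      by (simp add: algebra_simps)
  next
    case (step2 i)
    then show ?case
      using Fib_step[of "2 * i - 1"] Fib_step[of "2 * i - 2"]
        Fib_step[of "- (2 * i)"] Fib_step[of "- 1 - 2 * i"]
      by (simp add: algebra_simps)
  qed
  then show "Fib (- (2 * i)) = - Fib (2 * i)" "Fib (- 1 - 2 * i) = Fib (2 * i + 1)" by auto
qed

text \<open>The form y^2 - x y - x^2 at consecutive Fibonacci numbers changes sign when the index
  grows by one. A step of two therefore preserves it, and at (F(1), F(2)) = (1, 1) its value is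
  -1.\<close>

lemma Fib_Cassini_odd:
  assumes "odd n"
  shows "Fib (n + 1) ^ 2 - Fib n * Fib (n + 1) - Fib n ^ 2 = -1"
proof -
  have "Fib (2 * i + 2) ^ 2 - Fib (2 * i + 1) * Fib (2 * i + 2) - Fib (2 * i + 1) ^ 2 = -1" for i
  proof (induction i rule: int_induct[where k = 0])
    case base
    show ?case using Fib_rec[of 2] by (simp add: Fib_0 Fib_1)
  next
    case (step1 i)
    then show ?case
      using Fib_step[of "2 * i + 1"] Fib_step[of "2 * i + 2"]
      by (simp add: algebra_simps power2_eq_square)
  next
    case (step2 i)
    then show ?case
      using Fib_step[of "2 * i"] Fib_step[of "2 * i - 1"]
      by (simp add: algebra_simps power2_eq_square)
  qed
  with assms show ?thesis by (auto elim!: oddE simp: add.assoc)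
qed

text \<open>This is the addition law at \<open>- m\<close>: for odd \<open>m\<close>, reflection
  keeps F(m) and negates F(m+1).\<close>

lemma Fib_diff_odd:
  assumes "odd m"
  shows "Fib (n - m) = Fib m * Fib (n + 1) - Fib (m + 1) * Fib n"
proof -
  from assms obtain i where m: "m = 2 * i + 1" by (elim oddE)
  show ?thesis
    using Fib_add[of n "- m"] Fib_reflect(2)[of i] Fib_reflect(1)[of "i + 1"]
    by (simp add: m algebra_simps)
qed

lemma Fib_sum_diff:
  assumes "odd m"
  shows "Fib (n + m) - Fib (n - m) = Luc m * Fib n"
  unfolding Fib_diff_odd[OF assms] Fib_add[of n m] Luc_eq_Fib by (simp add: algebra_simps)

lemma Fib_sum_mult_diff:
  assumes "odd m" "odd n"
  shows "Fib (n - m) * Fib (n + m) = Fib n ^ 2 - Fib m ^ 2"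
proof -
  have "Fib (m - 1) = Fib (m + 1) - Fib m"
    using Fib_step[of "m - 1"] by (simp add: algebra_simps)
  \<comment> \<open>The product is arranged into the Cassini forms of \<open>n\<close> and
    \<open>m\<close>, each equal to -1; the two terms in F(m)^2 F(n)^2 cancel.\<close>
  then have "Fib (n - m) * Fib (n + m) =
      Fib m ^ 2 * (Fib (n + 1) ^ 2 - Fib n * Fib (n + 1) - Fib n ^ 2)
      - Fib n ^ 2 * (Fib (m + 1) ^ 2 - Fib m * Fib (m + 1) - Fib m ^ 2)"
    unfolding Fib_diff_odd[OF assms(1)] Fib_add[of n m] by algebra
  then show ?thesis
    unfolding Fib_Cassini_odd[OF assms(1)] Fib_Cassini_odd[OF assms(2)] by simp
qed

text \<open>Consecutive even-indexed values differ by an odd-indexed one, a positive integer, so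
  they grow by at least 1 per step. The induction needs the signed version; the linear bound is
  crude but enough for the limit.\<close>

lemma Fib_even_bound: "\<bar>i\<bar> \<le> \<bar>Fib (2 * i)\<bar>"
proof -
  have "(0 \<le> i \<longrightarrow> i \<le> Fib (2 * i)) \<and> (i \<le> 0 \<longrightarrow> Fib (2 * i) \<le> i)"
  proof (induction i rule: int_induct[where k = 0])
    case base
    show ?case by (simp add: Fib_0)
  next
    case (step1 i)
    then show ?case
      using Fib_step[of "2 * i"] Fib_odd_pos[of i] by (simp add: algebra_simps)
  next
    case (step2 i)
    then show ?case
      using Fib_step[of "2 * i - 2"] Fib_odd_pos[of "i - 1"] by (simp add: algebra_simps)
  qed
  then show ?thesis by linarith
qed

section \<open>Telescoping and passage to the limit\<close>

lemma sum_telescope_int: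
  fixes f :: "int \<Rightarrow> 'a::ab_group_add"
  assumes "p \<le> N"
  shows "(\<Sum>r = p..N. f r - f (r + 1)) = f p - f (N + 1)"
  using assms
proof (induction N rule: int_ge_induct)
  case base
  show ?case by simp
next
  case (step i)
  have "{p..i + 1} = insert (i + 1) {p..i}" using step.hyps by auto
  then show ?case using step.IH by (simp add: algebra_simps)
qed

theorem theorem2:
  fixes lam :: real and j k p :: int
  assumes "\<And>r. r \<ge> p \<Longrightarrow>
      real_of_int (Fib (4*j*r - 2*r + 2*k - 1))^2 - real_of_int (Fib (2*j - 1))^2 > 0 \<or>
      real_of_int (Fib (4*j*r - 2*r + 2*k - 1))^2 - real_of_int (Fib (2*j - 1))^2 + lam^2 < 0"
  shows "((\<lambda>N::int. \<Sum>r = p..N.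
        arctan (lam * real_of_int (Luc (2*j - 1)) * real_of_int (Fib (4*j*r - 2*r + 2*k - 1)) /
          (real_of_int (Fib (4*j*r - 2*r + 2*k - 1))^2 - real_of_int (Fib (2*j - 1))^2 + lam^2)))
      \<longlongrightarrow> arctan (lam / real_of_int (Fib (4*j*p - 2*p + 2*k - 2*j)))) at_top"
    (is "((\<lambda>N. \<Sum>r = p..N. ?s r) \<longlongrightarrow> _) at_top")
proof -
  define G where "G r = real_of_int (Fib (4*j*r - 2*r + 2*k - 2*j))" for r
  define f where "f r = arctan (lam / G r)" for r
  have summand: "?s r = f r - f (r + 1)" if "r \<ge> p" for r
  proof -
    let ?n = "4*j*r - 2*r + 2*k - 1" and ?m = "2*j - 1"
    have idx: "?n - ?m = 4*j*r - 2*r + 2*k - 2*j"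
      "?n + ?m = 4*j*(r + 1) - 2*(r + 1) + 2*k - 2*j"
      by (simp_all add: algebra_simps)
    have "odd ?m" "odd ?n" by simp_all
    from Fib_sum_diff[OF this(1), of ?n] Fib_sum_mult_diff[OF this]
    have d: "G (r + 1) - G r = real_of_int (Luc ?m) * real_of_int (Fib ?n)"
      and m: "real_of_int (Fib ?n)^2 - real_of_int (Fib ?m)^2 = G r * G (r + 1)"
      unfolding G_def idx by (simp_all flip: of_int_diff of_int_mult of_int_power)
    have c: "G r * G (r + 1) > 0 \<or> G r * G (r + 1) + lam^2 < 0"
      using assms[OF that] unfolding m .
    \<comment> \<open>Either alternative rules out a zero product, the second because
      \<open>lam^2\<close> is nonnegative.\<close>
    then have nz: "G r \<noteq> 0" "G (r + 1) \<noteq> 0"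
      by (auto simp: not_less)
    have prod: "lam / G r * (lam / G (r + 1)) = lam^2 / (G r * G (r + 1))"
      by (simp add: power2_eq_square)
    have "lam / G r * (lam / G (r + 1)) > -1"
      using c
    proof
      assume "G r * G (r + 1) > 0"
      then have "lam^2 / (G r * G (r + 1)) \<ge> 0" by simp
      then show ?thesis unfolding prod by linarith
    next
      \<comment> \<open>Here the product of the \<open>G\<close> values is below
        \<open>- lam^2\<close>, so dividing \<open>lam^2\<close> by it gives a quotient above
        -1.\<close>
      assume neg: "G r * G (r + 1) + lam^2 < 0"
      then have "G r * G (r + 1) < 0" by (smt (verit) zero_le_power2)
      with neg show ?thesis unfolding prod by (simp add: less_divide_eq)
    qed
    then have "f r - f (r + 1) =
        arctan ((lam / G r - lam / G (r + 1)) / (1 + lam / G r * (lam / G (r + 1))))"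
      unfolding f_def by (rule arctan_diff_eq)
    also have "(lam / G r - lam / G (r + 1)) / (1 + lam / G r * (lam / G (r + 1)))
        = (lam * (G (r + 1) - G r) / (G r * G (r + 1))) /
          ((G r * G (r + 1) + lam^2) / (G r * G (r + 1)))"
      using nz by (simp add: field_simps power2_eq_square)
    also have "\<dots> = lam * (G (r + 1) - G r) / (G r * G (r + 1) + lam^2)"
      using nz by simp
    finally show ?thesis unfolding d m by (simp add: mult.assoc)
  qed
  \<comment> \<open>The index is \<open>2 * ?e\<close>, and the odd factor \<open>2*j - 1\<close>
    has absolute value at least 1. Hence the bound holds for either sign of this factor, also when
    the indices run to minus infinity.\<close>
  have bound: "real_of_int (r - \<bar>k - j\<bar>) \<le> norm (G r)" for r
  proof -
    let ?e = "(2*j - 1) * r + (k - j)"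
    have "4*j*r - 2*r + 2*k - 2*j = 2 * ?e" by (simp add: algebra_simps)
    then have "norm (G r) = real_of_int \<bar>Fib (2 * ?e)\<bar>"
      unfolding G_def by (simp only: of_int_abs real_norm_def)
    then have "real_of_int \<bar>?e\<bar> \<le> norm (G r)"
      using Fib_even_bound[of ?e] by (simp only: of_int_le_iff)
    moreover have "1 \<le> \<bar>2*j - 1\<bar>" by presburger
    then have "\<bar>r\<bar> \<le> \<bar>(2*j - 1) * r\<bar>"
      using mult_right_mono[of 1 "\<bar>2*j - 1\<bar>" "\<bar>r\<bar>"] by (simp add: abs_mult)
    then have "r - \<bar>k - j\<bar> \<le> \<bar>?e\<bar>" by linarith
    ultimately show ?thesis by linarith
  qed
  have "filterlim (\<lambda>r::int. r + - \<bar>k - j\<bar>) at_top at_top"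
    unfolding filterlim_at_top
  proof
    fix Z
    show "\<forall>\<^sub>F r in at_top. Z \<le> r + - \<bar>k - j\<bar>"
      using eventually_ge_at_top[of "Z + \<bar>k - j\<bar>"] by eventually_elim simp
  qed
  then have "filterlim (\<lambda>r. real_of_int (r - \<bar>k - j\<bar>)) at_top at_top"
    by (intro filterlim_compose[OF filterlim_real_of_int_at_top]) simp
  then have "filterlim (\<lambda>r. norm (G r)) at_top at_top"
    by (rule filterlim_at_top_mono) (intro always_eventually allI bound)
  then have "filterlim G at_infinity at_top"
    by (simp add: filterlim_at_infinity_conv_norm_at_top)
  then have "((\<lambda>r. lam / G r) \<longlongrightarrow> 0) at_top"
    by (intro tendsto_divide_0[OF tendsto_const])
  from tendsto_arctan[OF this] have f0: "(f \<longlongrightarrow> 0) at_top"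
    by (simp add: f_def[abs_def])
  have "filterlim (\<lambda>N::int. N + 1) at_top at_top"
    unfolding filterlim_at_top
  proof
    fix Z :: int
    show "\<forall>\<^sub>F N in at_top. Z \<le> N + 1"
      using eventually_ge_at_top[of Z] by eventually_elim simp
  qed
  then have "((\<lambda>N. f p - f (N + 1)) \<longlongrightarrow> f p - 0) at_top"
    by (intro tendsto_diff tendsto_const filterlim_compose[OF f0])
  \<comment> \<open>The telescoped form is available only for \<open>p \<le> N\<close>, which
    suffices for a limit at \<open>at_top\<close>.\<close>
  moreover have "\<forall>\<^sub>F N in at_top. f p - f (N + 1) = (\<Sum>r = p..N. ?s r)"
    using eventually_ge_at_top[of p]
  proof eventually_elim
    case (elim N)
    have "(\<Sum>r = p..N. ?s r) = (\<Sum>r = p..N. f r - f (r + 1))"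
      by (rule sum.cong) (auto simp: summand)
    with sum_telescope_int[OF elim, of f] show ?case by simp
  qed
  ultimately have "((\<lambda>N. \<Sum>r = p..N. ?s r) \<longlongrightarrow> f p - 0) at_top"
    by (rule Lim_transform_eventually)
  then show ?thesis by (simp add: f_def G_def)
qed

end
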